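(* Let $g,h$ be non-negative integers and let $S=R\cup B$ be a set of $3g+h$ red points and $3h+g$ blue points in the plane in convex position (and general position). Then at least $4(g+h)-4$ points of $S$ can be $K_{1,3}$-covered. Moreover, this bound is tight: for every integer $g\ge 1$ there is a set of $4g$ red and $4g$ blue points in convex position (i.e., the case $h=g$) for which no more than $8g-4$ points can be $K_{1,3}$-covered.
   Context: General position: no three points collinear; convex position: every point is a vertex of the convex hull. A subset $X\subseteq S$ can be $K_{1,3}$-covered if $X$ can be partitioned into subsets of size $4$, each consisting of one point (the center) of one color and three points of the other color, such that the straight-line segments joining each center to the three other points of its subset are pairwise non-crossing (no two intersect except at a common endpoint). "At least $k$ points of $S$ can be $K_{1,3}$-covered" means some subset $X\subseteq S$ with $|X|\ge k$ can be $K_{1,3}$-covered. *)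

theory Defs
  imports "HOL-Analysis.Analysis"
begin

definition general_position :: "(real^2) set \<Rightarrow> bool" where
  "general_position S \<longleftrightarrow>
     (\<forall>a\<in>S. \<forall>b\<in>S. \<forall>c\<in>S. a \<noteq> b \<and> b \<noteq> c \<and> a \<noteq> c \<longrightarrow> \<not> collinear {a, b, c})"

definition convex_position :: "(real^2) set \<Rightarrow> bool" where
  "convex_position S \<longleftrightarrow> (\<forall>p\<in>S. p extreme_point_of (convex hull S))"

definition star_edges ::
  "(real^2) set set \<Rightarrow> ((real^2) set \<Rightarrow> real^2) \<Rightarrow> ((real^2) \<times> (real^2)) set" where
  "star_edges P ctr = {(ctr A, q) | A q. A \<in> P \<and> q \<in> A - {ctr A}}"

definition non_crossing :: "((real^2) \<times> (real^2)) set \<Rightarrow> bool" where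
  "non_crossing E \<longleftrightarrow>
     (\<forall>(a, b)\<in>E. \<forall>(c, d)\<in>E. (a, b) \<noteq> (c, d) \<longrightarrow>
        closed_segment a b \<inter> closed_segment c d \<subseteq> {a, b} \<inter> {c, d})"

text \<open>
  \<open>R\<close> and \<open>B\<close> are the two colour classes; \<open>ctr A\<close> is the center of the block \<open>A\<close>.
  Non-crossing is required of the segments of all the stars together.
\<close>

definition K13_coverable :: "(real^2) set \<Rightarrow> (real^2) set \<Rightarrow> (real^2) set \<Rightarrow> bool" where
  "K13_coverable R B X \<longleftrightarrow>
     (\<exists>P ctr. partition_on X P \<and>
        (\<forall>A\<in>P. card A = 4 \<and> ctr A \<in> A \<and>
           (ctr A \<in> R \<and> A - {ctr A} \<subseteq> B \<or> ctr A \<in> B \<and> A - {ctr A} \<subseteq> R)) \<and>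
        non_crossing (star_edges P ctr))"

end

theory Submission
  imports Defs
begin

text \<open>
  Covering: order the points counterclockwise and delete one red point, so that their number \<open>n\<close> becomes
  odd. Let \<open>f i\<close> be the number of red points among the four cyclically consecutive points starting at
  position \<open>i\<close>. Consecutive values of \<open>f\<close> differ by at most one and their sum is four times the
  number of red points. If \<open>f\<close> avoided the values 1 and 3 it would be constantly 2, so that \<open>n\<close> would be
  twice the number of red points; in the extreme cases \<open>g = 0\<close> or \<open>h = 0\<close> the average even forces
  the value 1 or 3 that keeps the parameters non-negative. A window with colours split 3:1 is a star
  that can be separated from all other points by a line, so it can be removed; as the parity of \<open>n\<close> is
  preserved, one can continue until three points remain.

  Tightness: take points alternating in colour along a parabola. In a complete non-crossing cover the
  block of smallest span would consist of four consecutive points, which are coloured 2:2.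
\<close>

section \<open>Orientation and counterclockwise lists\<close>

text \<open>Twice the signed area of the triangle \<open>a\<close>, \<open>b\<close>,
  \<open>c\<close>; it is positive exactly for a left turn.\<close>

definition orient :: "real^2 \<Rightarrow> real^2 \<Rightarrow> real^2 \<Rightarrow> real" where
  "orient a b c = (b$1 - a$1) * (c$2 - a$2) - (b$2 - a$2) * (c$1 - a$1)"

lemma orient_rotate: "orient b c a = orient a b c"
  by (simp add: orient_def algebra_simps)

lemma orient_swap: "orient a c b = - orient a b c"
  by (simp add: orient_def algebra_simps)

lemma orient_degenerate [simp]: "orient a a b = 0" "orient a b a = 0" "orient a b b = 0"
  by (simp_all add: orient_def)

text \<open>Being affine in the last argument is what makes the half-planes bounded by a line
  convex.\<close>

lemma orient_affine:
  assumes "u + v = 1"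
  shows "orient a b (u *\<^sub>R x + v *\<^sub>R y) = u * orient a b x + v * orient a b y"
proof -
  have "a$1 = u * a$1 + v * a$1" "a$2 = u * a$2 + v * a$2"
    using assms by (simp_all flip: distrib_right)
  moreover have "orient a b (u *\<^sub>R x + v *\<^sub>R y) =
    (b$1 - a$1) * (u * x$2 + v * y$2 - a$2) - (b$2 - a$2) * (u * x$1 + v * y$1 - a$1)"
    by (simp add: orient_def)
  moreover have "u * x$2 + v * y$2 - (u * a$2 + v * a$2) = u * (x$2 - a$2) + v * (y$2 - a$2)"
    "u * x$1 + v * y$1 - (u * a$1 + v * a$1) = u * (x$1 - a$1) + v * (y$1 - a$1)"
    by (simp_all add: algebra_simps)
  ultimately have "orient a b (u *\<^sub>R x + v *\<^sub>R y) =
    (b$1 - a$1) * (u * (x$2 - a$2) + v * (y$2 - a$2)) - (b$2 - a$2) * (u * (x$1 - a$1) + v * (y$1 - a$1))"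
    by simp
  then show ?thesis
    by (simp add: orient_def algebra_simps)
qed

lemma convex_orient_gt: "convex {x. orient a b x > 0}"
  unfolding convex_def
  by (auto simp: orient_affine)
    (metis add_nonneg_pos add_pos_nonneg mult_nonneg_nonneg mult_pos_pos less_eq_real_def
      add.right_neutral zero_neq_one)

lemma convex_orient_le: "convex {x. orient a b x \<le> 0}"
  unfolding convex_def
  by (auto simp: orient_affine mult_nonneg_nonpos add_nonpos_nonpos)

lemma collinear_iff_orient: "collinear {a, b, c} \<longleftrightarrow> orient a b c = 0"
proof -
  have "collinear {a, b, c} \<longleftrightarrow> collinear {0, b - a, c - a}"
    using collinear_3[of b a c] by (simp add: insert_commute NO_MATCH_def)
  also have "\<dots> \<longleftrightarrow> orient a b c = 0"
  proof
    assume "collinear {0, b - a, c - a}"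
    then consider "b = a" | "c = a" | k where "c - a = k *\<^sub>R (b - a)"
      by (auto simp: collinear_lemma)
    then show "orient a b c = 0"
    proof cases
      case 3
      then have "c$1 - a$1 = k * (b$1 - a$1)" "c$2 - a$2 = k * (b$2 - a$2)"
        by (metis real_scaleR_def vector_minus_component vector_scaleR_component)+
      then show ?thesis by (simp add: orient_def)
    qed simp_all
  next
    assume o: "orient a b c = 0"
    show "collinear {0, b - a, c - a}"
    proof (cases "b = a")
      case False
      \<comment> \<open>The factor \<open>k\<close> is the quotient of the differences in a
        coordinate where \<open>a\<close> and \<open>b\<close> differ.\<close>
      then consider "b$1 \<noteq> a$1" | "b$2 \<noteq> a$2"
        by (auto simp: vec_eq_iff forall_2)
      then have "\<exists>k. c - a = k *\<^sub>R (b - a)"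
      proof cases
        case 1
        then have "c$2 - a$2 = (c$1 - a$1) / (b$1 - a$1) * (b$2 - a$2)"
          using o by (simp add: orient_def eq_divide_eq mult.commute)
        with 1 have "c - a = ((c$1 - a$1) / (b$1 - a$1)) *\<^sub>R (b - a)"
          by (simp add: vec_eq_iff forall_2)
        then show ?thesis by blast
      next
        case 2
        then have "c$1 - a$1 = (c$2 - a$2) / (b$2 - a$2) * (b$1 - a$1)"
          using o by (simp add: orient_def eq_divide_eq mult.commute)
        with 2 have "c - a = ((c$2 - a$2) / (b$2 - a$2)) *\<^sub>R (b - a)"
          by (simp add: vec_eq_iff forall_2)
        then show ?thesis by blast
      qed
      then show ?thesis by (auto simp: collinear_lemma)
    qed simp
  qed
  finally show ?thesis .
qed

text \<open>Unfolding the recursion, any three entries in list order make a left turn. Since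
  \<open>orient\<close> is cyclically invariant, this depends only on the cyclic order.\<close>

fun ccw :: "(real^2) list \<Rightarrow> bool" where
  "ccw [] \<longleftrightarrow> True"
| "ccw (p # xs) \<longleftrightarrow> sorted_wrt (\<lambda>a b. orient p a b > 0) xs \<and> ccw xs"

text \<open>Groups the same triples by their last instead of their first point, as needed when the
  head moves to the end.\<close>

lemma ccw_snoc: "ccw (xs @ [p]) \<longleftrightarrow> ccw xs \<and> sorted_wrt (\<lambda>a b. orient a b p > 0) xs"
  by (induction xs) (auto simp: sorted_wrt_append)

lemma ccw_rotate1: "ccw xs \<Longrightarrow> ccw (rotate1 xs)"
  by (cases xs) (simp_all add: ccw_snoc orient_rotate)

lemma ccw_rotate: "ccw xs \<Longrightarrow> ccw (rotate n xs)"
  by (induction n) (simp_all add: ccw_rotate1)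

lemma ccw_appendD2: "ccw (xs @ ys) \<Longrightarrow> ccw ys"
  by (induction xs) auto

text \<open>The line through the first and the last point of a block of consecutive points separates
  the block from the rest.\<close>

lemma ccw_hulls_disjoint:
  assumes "ccw ([a, b, c, d] @ ys)"
  shows "convex hull {a, b, c, d} \<inter> convex hull (set ys) = {}"
proof -
  have "{a, b, c, d} \<subseteq> {x. orient a d x \<le> 0}"
    using assms orient_swap[of a d b] orient_swap[of a d c] by auto
  then have "convex hull {a, b, c, d} \<subseteq> {x. orient a d x \<le> 0}"
    by (rule hull_minimal) (rule convex_orient_le)
  moreover have "set ys \<subseteq> {x. orient a d x > 0}"
    using assms by auto
  then have "convex hull (set ys) \<subseteq> {x. orient a d x > 0}"
    by (rule hull_minimal) (rule convex_orient_gt)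
  ultimately show ?thesis by force
qed

section \<open>Counterclockwise order of points in convex position\<close>

lemma convex_position_notin_hull:
  assumes "convex_position S" "p \<in> S" "T \<subseteq> S - {p}"
  shows "p \<notin> convex hull T"
proof -
  \<comment> \<open>Deleting an extreme point keeps a convex set convex, so the hull of the other
    points avoids \<open>p\<close>.\<close>
  have "convex (convex hull S - {p})"
    using assms extreme_point_of_stillconvex[of "convex hull S" p] unfolding convex_position_def
    by simp
  moreover have "T \<subseteq> convex hull S - {p}"
    using assms(3) hull_subset[of S convex] by auto
  ultimately have "convex hull T \<subseteq> convex hull S - {p}"
    by (rule hull_minimal[rotated])
  then show ?thesis by auto
qed

text \<open>The barycentric coordinates of \<open>b\<close> in the triangle \<open>p\<close>,
  \<open>a\<close>, \<open>c\<close> are quotients of signed areas, and the sign assumptions make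
  all three nonnegative.\<close>

lemma in_triangle_if_orient:
  assumes "orient p a b > 0" "orient p b c > 0" "orient p a c > 0" "orient a b c \<le> 0"
  shows "b \<in> convex hull {p, a, c}"
proof -
  define D where "D = orient p a c"
  have D: "D > 0" using assms D_def by simp
  let ?u = "- orient a b c / D" and ?v = "orient p b c / D" and ?w = "orient p a b / D"
  have "?u + ?v + ?w = (- orient a b c + orient p b c + orient p a b) / D"
    by (simp add: add_divide_distrib diff_divide_distrib)
  also have "\<dots> = 1"
    using D by (simp add: D_def orient_def algebra_simps)
  finally have "?u + ?v + ?w = 1" .
  moreover have "D *\<^sub>R b = (- orient a b c) *\<^sub>R p + orient p b c *\<^sub>R a + orient p a b *\<^sub>R c"
    by (simp add: vec_eq_iff forall_2 D_def orient_def algebra_simps)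
  then have "(1 / D) *\<^sub>R D *\<^sub>R b =
      (1 / D) *\<^sub>R ((- orient a b c) *\<^sub>R p + orient p b c *\<^sub>R a + orient p a b *\<^sub>R c)"
    by simp
  then have "b = ?u *\<^sub>R p + ?v *\<^sub>R a + ?w *\<^sub>R c"
    using D by (simp add: scaleR_add_right scaleR_diff_right)
  moreover have "?u \<ge> 0" "?v \<ge> 0" "?w \<ge> 0"
    using assms D by (simp_all add: divide_nonpos_pos)
  ultimately show ?thesis
    unfolding convex_hull_3 by blast
qed

text \<open>The second assumption transfers the angular order about \<open>p\<close> to each list
  entry in turn; induction then covers all triples.\<close>

lemma ccw_if_sorted_around:
  assumes "sorted_wrt (\<lambda>a b. orient p a b > 0) ys"
    and "\<And>a b c. \<lbrakk>a \<in> set ys; b \<in> set ys; c \<in> set ys; orient p a b > 0; orient p b c > 0;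
           orient p a c > 0\<rbrakk> \<Longrightarrow> orient a b c > 0"
  shows "ccw ys"
  using assms
proof (induction ys)
  case (Cons a ys)
  have "sorted_wrt (\<lambda>b c. orient a b c > 0) ys"
    by (rule sorted_wrt_mono_rel[where P = "\<lambda>b c. orient p b c > 0"]) (use Cons.prems in auto)
  then show ?case using Cons by auto
qed simp

text \<open>A line strictly separates one point \<open>p\<close> from the others, so they can be
  sorted by angle about \<open>p\<close>. A right turn later in the list would put a point inside a
  triangle of others.\<close>

lemma convex_position_ccw_list:
  assumes "finite S" "convex_position S" "general_position S"
  obtains xs where "distinct xs" "set xs = S" "ccw xs"
proof (cases "S = {}")
  case True
  then show ?thesis using that[of "[]"] by simp
next
  case False
  then obtain p where p: "p \<in> S" by blast
  let ?T = "S - {p}"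
  have "p \<notin> convex hull ?T"
    using convex_position_notin_hull assms(2) p by blast
  moreover have "closed (convex hull ?T)"
    using assms(1) by (simp add: compact_imp_closed finite_imp_compact_convex_hull)
  ultimately obtain u t where ut: "u \<bullet> p < t" "\<forall>x\<in>convex hull ?T. u \<bullet> x > t"
    using separating_hyperplane_closed_point[of "convex hull ?T" p] by auto
  \<comment> \<open>Up to the factor |u|, \<open>\<phi>\<close> and \<open>\<psi>\<close> are the
    coordinates of \<open>x - p\<close> along \<open>u\<close> and along \<open>u\<close> turned by
    a quarter counterclockwise.\<close>
  define \<phi> where "\<phi> x = u$1 * (x$1 - p$1) + u$2 * (x$2 - p$2)" for x :: "real^2"
  define \<psi> where "\<psi> x = u$1 * (x$2 - p$2) - u$2 * (x$1 - p$1)" for x :: "real^2"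
  have \<phi>_pos: "\<phi> x > 0" if "x \<in> ?T" for x
  proof -
    have "x \<in> convex hull ?T" using that by (rule hull_inc)
    then have "u \<bullet> x > u \<bullet> p" using ut by force
    then show ?thesis by (simp add: \<phi>_def inner_vec_def sum_2 algebra_simps)
  qed
  \<comment> \<open>The change of coordinates is a rotation scaled by |u|, so it multiplies
    determinants by |u| squared.\<close>
  have orient_eq: "\<phi> x * \<psi> y - \<psi> x * \<phi> y = ((u$1)\<^sup>2 + (u$2)\<^sup>2) * orient p x y" for x y
    by (simp add: \<phi>_def \<psi>_def orient_def power2_eq_square algebra_simps)
  \<comment> \<open>The tangent of the angle from \<open>u\<close> to \<open>x - p\<close>; it
    increases with the angle because \<open>\<phi>\<close> is positive.\<close>
  define key where "key x = \<psi> x / \<phi> x" for x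
  have key: "orient p x y > 0" if "x \<in> ?T" "y \<in> ?T" "x \<noteq> y" "key x \<le> key y" for x y
  proof -
    have "\<psi> x * \<phi> y \<le> \<psi> y * \<phi> x"
      using that \<phi>_pos[of x] \<phi>_pos[of y] by (simp add: key_def field_simps)
    then have "((u$1)\<^sup>2 + (u$2)\<^sup>2) * orient p x y \<ge> 0"
      unfolding orient_eq[symmetric] by (simp add: mult.commute)
    moreover have "u \<noteq> 0"
      using \<phi>_pos[OF that(1)] by (auto simp: \<phi>_def)
    then have "(u$1)\<^sup>2 + (u$2)\<^sup>2 > 0"
      by (auto simp: vec_eq_iff forall_2 sum_power2_gt_zero_iff)
    ultimately have "orient p x y \<ge> 0"
      by (simp add: zero_le_mult_iff)
    moreover have "orient p x y \<noteq> 0"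
      using assms(3)[unfolded general_position_def, rule_format, of p x y] p that
      by (auto simp: collinear_iff_orient)
    ultimately show ?thesis by simp
  qed
  obtain zs where zs: "distinct zs" "set zs = ?T"
    using finite_distinct_list[of ?T] assms(1) by auto
  define ys where "ys = sort_key key zs"
  have ys: "distinct ys" "set ys = ?T"
    using zs by (simp_all add: ys_def)
  have "sorted_wrt (\<lambda>x y. key x \<le> key y) ys"
    using sorted_sort_key[of key zs] by (simp add: ys_def sorted_wrt_map)
  \<comment> \<open>Sorting gives only weak inequalities; distinctness, through general position,
    makes the turns strict.\<close>
  then have "sorted_wrt (\<lambda>x y. x \<noteq> y \<and> key x \<le> key y) ys"
    using ys(1)
    by (simp add: sorted_wrt_iff_nth_less nth_eq_iff_index_eq)
  then have sorted: "sorted_wrt (\<lambda>x y. orient p x y > 0) ys"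
    by (rule sorted_wrt_mono_rel[rotated]) (use ys key in auto)
  moreover have "ccw ys"
  proof (rule ccw_if_sorted_around[OF sorted])
    fix a b c
    assume abc: "a \<in> set ys" "b \<in> set ys" "c \<in> set ys"
      "orient p a b > 0" "orient p b c > 0" "orient p a c > 0"
    have "a \<in> S" "b \<in> S" "c \<in> S" "p \<noteq> b"
      using abc(1-3) ys(2) by blast+
    moreover have "a \<noteq> b" "c \<noteq> b"
      using abc(4,5) by force+
    ultimately have "{p, a, c} \<subseteq> S - {b}"
      using p by blast
    then have "b \<notin> convex hull {p, a, c}"
      using convex_position_notin_hull[OF assms(2) \<open>b \<in> S\<close>] by blast
    then show "orient a b c > 0"
      using in_triangle_if_orient abc by (meson not_le)
  qed
  ultimately show ?thesis
    using that[of "p # ys"] ys p by auto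
qed

section \<open>Removing a window of four consecutive points\<close>

text \<open>Discrete intermediate value principle: steps of size at most one cannot jump over
  \<open>v\<close>.\<close>

lemma no_jump:
  fixes f :: "nat \<Rightarrow> nat"
  assumes "\<And>i. f (Suc i) \<le> f i + 1" "\<And>i. f i \<le> f (Suc i) + 1" "\<And>i. f i \<noteq> v"
  shows "(\<forall>i. f i < v) \<or> (\<forall>i. f i > v)"
proof (cases "f 0 < v")
  case True
  have "f i < v" for i
  proof (induction i)
    case (Suc i)
    then show ?case using assms(1)[of i] assms(3)[of "Suc i"] by linarith
  qed (fact True)
  then show ?thesis by blast
next
  case False
  have "f i > v" for i
  proof (induction i)
    case 0
    then show ?case using False assms(3)[of 0] by linarith
  next
    case (Suc i)
    then show ?case using assms(2)[of i] assms(3)[of "Suc i"] by linarith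
  qed
  then show ?thesis by blast
qed

text \<open>Each further shift trades the term \<open>\<rho> k\<close> for the equal term
  \<open>\<rho> (k + n)\<close>.\<close>

lemma sum_shift_periodic:
  fixes \<rho> :: "nat \<Rightarrow> nat"
  assumes "\<And>i. \<rho> (i + n) = \<rho> i"
  shows "(\<Sum>i<n. \<rho> (i + k)) = (\<Sum>i<n. \<rho> i)"
proof (induction k)
  case (Suc k)
  have "\<rho> k + (\<Sum>i<n. \<rho> (i + Suc k)) = (\<Sum>i<Suc n. \<rho> (i + k))"
    by (subst sum.lessThan_Suc_shift) simp
  also have "\<dots> = (\<Sum>i<n. \<rho> (i + k)) + \<rho> k"
    using assms[of k] by (simp add: add.commute)
  finally show ?case using Suc by simp
qed simp

text \<open>\<open>\<rho>\<close> is the cyclic indicator of red, and the added 1 in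
  \<open>r\<close> and \<open>n\<close> is the deleted red point. A window with one red point will
  lower \<open>h\<close>, one with three will lower \<open>g\<close>, hence the side
  conditions.\<close>

lemma window_exists:
  fixes \<rho> :: "nat \<Rightarrow> nat"
  assumes per: "\<And>i. \<rho> (i + n) = \<rho> i" and le1: "\<And>i. \<rho> i \<le> 1"
    and r: "(\<Sum>i<n. \<rho> i) + 1 = 3 * g + h" and n: "n + 1 = 4 * (g + h)" and gh: "g + h \<ge> 2"
  shows "\<exists>i. (\<rho> i + \<rho> (i+1) + \<rho> (i+2) + \<rho> (i+3) = 1 \<and> h \<ge> 1) \<or>
             (\<rho> i + \<rho> (i+1) + \<rho> (i+2) + \<rho> (i+3) = 3 \<and> g \<ge> 1)"
proof -
  define f where "f i = \<rho> i + \<rho> (i+1) + \<rho> (i+2) + \<rho> (i+3)" for i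
  have f_Suc: "f (Suc i) + \<rho> i = f i + \<rho> (i+4)" for i
    by (simp add: f_def numeral_eq_Suc)
  have up: "f (Suc i) \<le> f i + 1" and down: "f i \<le> f (Suc i) + 1" for i
    using f_Suc[of i] le1[of i] le1[of "i+4"] by linarith+
  have sum_f: "(\<Sum>i<n. f i) = 4 * (\<Sum>i<n. \<rho> i)"
    using sum_shift_periodic[of \<rho> n 1, OF per] sum_shift_periodic[of \<rho> n 2, OF per]
      sum_shift_periodic[of \<rho> n 3, OF per] by (simp add: f_def sum.distrib)
  \<comment> \<open>Both bounds compare \<open>f\<close> with its average; the 4 is the deleted red
    point, weighted by the window length.\<close>
  have upper: "4 * (3 * g + h) \<le> k * n + 4" if "\<And>i. f i \<le> k" for k
    using sum_bounded_above[of "{..<n}" f k] that sum_f r by (simp add: mult.commute)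
  have lower: "k * n + 4 \<le> 4 * (3 * g + h)" if "\<And>i. f i \<ge> k" for k
    using sum_bounded_below[of "{..<n}" k f] that sum_f r by (simp add: mult.commute)
  note jump = no_jump[of f, OF up down]
  have v1: "\<exists>i. f i = 1" if "\<not> (\<forall>i. f i \<ge> 2)" "3 * g + h \<ge> 2"
  proof (rule ccontr)
    assume "\<not> ?thesis"
    then have "(\<forall>i. f i < 1) \<or> (\<forall>i. f i > 1)" by (intro jump) auto
    then show False
    proof
      \<comment> \<open>Then no red point would be left, while \<open>3 * g + h \<ge> 2\<close>
        leaves at least one after the deletion.\<close>
      assume "\<forall>i. f i < 1"
      then have "f i \<le> 0" for i by (simp add: less_Suc_eq_le)
      from upper[OF this] that(2) show False by simp
    qed (use that in \<open>auto simp: Suc_le_eq numeral_2_eq_2\<close>)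
  qed
  have v3: "\<exists>i. f i = 3" if "\<not> (\<forall>i. f i \<le> 2)"
  proof (rule ccontr)
    assume "\<not> ?thesis"
    then have "(\<forall>i. f i < 3) \<or> (\<forall>i. f i > 3)" by (intro jump) auto
    then show False
    proof
      assume "\<forall>i. f i > 3"
      then have "4 \<le> f i" for i using Suc_leI by fastforce
      from lower[OF this] n gh r show False
      proof -
        assume "4 * n + 4 \<le> 4 * (3 * g + h)"
        then show False using n gh by simp
      qed
    qed (use that in \<open>auto simp: less_Suc_eq_le numeral_3_eq_3 numeral_2_eq_2\<close>)
  qed
  have "(\<exists>i. f i = 1 \<and> h \<ge> 1) \<or> (\<exists>i. f i = 3 \<and> g \<ge> 1)"
  proof (cases "g = 0")
    case True
    \<comment> \<open>For \<open>g = 0\<close> fewer than half of the points are red, so some window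
      has fewer than two; the case \<open>h = 0\<close> is the mirror image.\<close>
    have "\<not> (\<forall>i. f i \<ge> 2)" using lower[of 2] True n gh by auto
    then show ?thesis using v1 True gh by auto
  next
    case g: False
    show ?thesis
    proof (cases "h = 0")
      case True
      have "\<not> (\<forall>i. f i \<le> 2)" using upper[of 2] True n gh by auto
      then show ?thesis using v3 g by auto
    next
      case False
      \<comment> \<open>If \<open>f\<close> were constantly 2, then \<open>n\<close> would be even,
        but \<open>n + 1\<close> is a multiple of 4.\<close>
      have "\<not> ((\<forall>i. f i \<ge> 2) \<and> (\<forall>i. f i \<le> 2))"
      proof
        assume "(\<forall>i. f i \<ge> 2) \<and> (\<forall>i. f i \<le> 2)"
        then have "4 * (3 * g + h) = 2 * n + 4"
          using upper[of 2] lower[of 2] by (simp add: le_antisym)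
        then show False using n by presburger
      qed
      then show ?thesis using v1 v3 g False gh by auto
    qed
  qed
  then show ?thesis unfolding f_def by blast
qed

section \<open>Assembling stars into a cover\<close>

lemma K13_coverable_empty: "K13_coverable R B {}"
  unfolding K13_coverable_def non_crossing_def star_edges_def
  by (rule exI[of _ "{}"]) (simp add: partition_on_def)

text \<open>Old and new edges lie in disjoint hulls, and two new edges meet only at \<open>c\<close>
  because no three points of \<open>A\<close> are collinear.\<close>

lemma K13_coverable_Un:
  assumes X: "K13_coverable R B X" and gp: "general_position A"
    and A: "card A = 4" "c \<in> A" "c \<in> R \<and> A - {c} \<subseteq> B \<or> c \<in> B \<and> A - {c} \<subseteq> R"
    and disj: "convex hull A \<inter> convex hull X = {}"
  shows "K13_coverable R B (A \<union> X)"
proof -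
  obtain P ctr where P: "partition_on X P"
    and stars: "\<forall>A\<in>P. card A = 4 \<and> ctr A \<in> A \<and>
           (ctr A \<in> R \<and> A - {ctr A} \<subseteq> B \<or> ctr A \<in> B \<and> A - {ctr A} \<subseteq> R)"
    and nc: "non_crossing (star_edges P ctr)"
    using X unfolding K13_coverable_def by blast
  have AX: "A \<inter> X = {}"
    using disj hull_subset[of A convex] hull_subset[of X convex] by blast
  have UnP: "\<Union>P = X" using P by (simp add: partition_on_def)
  have "A \<notin> P" using AX UnP A(2) by blast
  define ctr' where "ctr' = ctr(A := c)"
  have ctr': "ctr' A = c" "\<And>D. D \<in> P \<Longrightarrow> ctr' D = ctr D"
    using \<open>A \<notin> P\<close> by (auto simp: ctr'_def)
  have edges: "star_edges (insert A P) ctr' = {(c, q) | q. q \<in> A - {c}} \<union> star_edges P ctr"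
    unfolding star_edges_def using ctr' by (auto; metis)
  have old: "closed_segment a b \<subseteq> convex hull X" if "(a, b) \<in> star_edges P ctr" for a b
  proof -
    have "{a, b} \<subseteq> X" using that stars UnP unfolding star_edges_def by auto
    then show ?thesis by (simp add: segment_convex_hull hull_mono)
  qed
  have new: "closed_segment c q \<subseteq> convex hull A" if "q \<in> A" for q
    using that A(2) by (simp add: segment_convex_hull hull_mono)
  have within: "closed_segment c q \<inter> closed_segment c q' \<subseteq> {c}"
    if "q \<in> A - {c}" "q' \<in> A - {c}" "q \<noteq> q'" for q q'
  proof -
    have "\<not> collinear {q, c, q'}"
      using gp[unfolded general_position_def, rule_format, of q c q'] that A(2) by auto
    then have "closed_segment q c \<inter> closed_segment c q' = {c}"
      by (intro Int_closed_segment) blast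
    then show ?thesis by (simp add: closed_segment_commute)
  qed
  have "non_crossing (star_edges (insert A P) ctr')"
    unfolding non_crossing_def edges
  proof (intro ballI case_prodI2 impI subsetI)
    fix x x' a b a' b' z
    assume "x = (a, b)" "x' = (a', b')"
      and "x \<in> {(c, q) | q. q \<in> A - {c}} \<union> star_edges P ctr"
        "x' \<in> {(c, q) | q. q \<in> A - {c}} \<union> star_edges P ctr"
      and ne: "(a, b) \<noteq> (a', b')"
      and "z \<in> closed_segment a b \<inter> closed_segment a' b'"
    then have e: "(a, b) \<in> {(c, q) | q. q \<in> A - {c}} \<union> star_edges P ctr"
      "(a', b') \<in> {(c, q) | q. q \<in> A - {c}} \<union> star_edges P ctr"
      and z: "z \<in> closed_segment a b" "z \<in> closed_segment a' b'"
      by simp_all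
    consider "(a, b) \<in> star_edges P ctr" "(a', b') \<in> star_edges P ctr"
      | "(a, b) \<in> star_edges P ctr" "a' = c" "b' \<in> A - {c}"
      | "(a', b') \<in> star_edges P ctr" "a = c" "b \<in> A - {c}"
      | "a = c" "b \<in> A - {c}" "a' = c" "b' \<in> A - {c}"
      using e by blast
    then show "z \<in> {a, b} \<inter> {a', b'}"
    proof cases
      case 1
      then have "closed_segment a b \<inter> closed_segment a' b' \<subseteq> {a, b} \<inter> {a', b'}"
        using nc ne unfolding non_crossing_def by blast
      then show ?thesis using z by blast
    next
      case 2
      then show ?thesis using old new z disj by blast
    next
      case 3
      then show ?thesis using old new z disj by blast
    next
      case 4
      then show ?thesis using within[of b b'] ne z by blast
    qed
  qed
  moreover have "partition_on (A \<union> X) (insert A P)"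
    using P AX A(2) UnP by (subst partition_on_insert) (auto simp: disjnt_def Un_Diff Diff_triv Int_commute)
  ultimately show ?thesis
    unfolding K13_coverable_def using stars A ctr'
    by (intro exI[of _ "insert A P"] exI[of _ ctr']) auto
qed

text \<open>Induction on \<open>g + h\<close>, splitting off one star each time. The list already
  misses one red point, so three points are left at \<open>g + h = 1\<close>, where the empty cover
  suffices.\<close>

lemma K13_coverable_ccw:
  assumes "R \<inter> B = {}" "general_position (R \<union> B)"
    and "distinct xs" "ccw xs" "set xs \<subseteq> R \<union> B"
    and "card (set xs \<inter> R) + 1 = 3 * g + h" "card (set xs \<inter> B) = 3 * h + g"
  shows "\<exists>X \<subseteq> set xs. K13_coverable R B X \<and> card X + 4 = 4 * (g + h)"
  using assms(3-)
proof (induction "g + h" arbitrary: g h xs rule: less_induct)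
  case less
  show ?case
  proof (cases "g + h \<ge> 2")
    case False
    then have "g + h = 1" using less.prems(4) by linarith
    then show ?thesis using K13_coverable_empty by (intro exI[of _ "{}"]) simp
  next
    case True
    define n where "n = length xs"
    have "card (set xs) = card (set xs \<inter> R) + card (set xs \<inter> B)"
      using assms(1) less.prems(3) by (subst card_Un_disjoint[symmetric]) (auto intro!: arg_cong[where f = card])
    then have n: "n + 1 = 4 * (g + h)"
      using less.prems by (simp add: n_def distinct_card)
    define \<rho> where "\<rho> i = (if xs ! (i mod n) \<in> R then 1 else 0 :: nat)" for i
    have "(\<Sum>i<n. \<rho> i) = (\<Sum>i<n. if xs ! i \<in> R then 1 else 0)"
      by (rule sum.cong) (simp_all add: \<rho>_def)
    also have "\<dots> = card {i. i < n \<and> xs ! i \<in> R}"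
      by (simp add: sum.If_cases Int_def)
    also have "\<dots> = card (set xs \<inter> R)"
      using length_filter_conv_card[of "\<lambda>x. x \<in> R" xs] distinct_card[of "filter (\<lambda>x. x \<in> R) xs"]
        less.prems(1) by (simp add: n_def Int_def)
    finally have sum_\<rho>: "(\<Sum>i<n. \<rho> i) + 1 = 3 * g + h"
      using less.prems by simp
    have "\<exists>i. (\<rho> i + \<rho> (i+1) + \<rho> (i+2) + \<rho> (i+3) = 1 \<and> h \<ge> 1) \<or>
             (\<rho> i + \<rho> (i+1) + \<rho> (i+2) + \<rho> (i+3) = 3 \<and> g \<ge> 1)"
      by (rule window_exists[OF _ _ sum_\<rho> n True]) (simp_all add: \<rho>_def)
    then obtain i where i: "(\<rho> i + \<rho> (i+1) + \<rho> (i+2) + \<rho> (i+3) = 1 \<and> h \<ge> 1) \<or>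
             (\<rho> i + \<rho> (i+1) + \<rho> (i+2) + \<rho> (i+3) = 3 \<and> g \<ge> 1)" by blast
    \<comment> \<open>Rotating by \<open>i\<close> brings the cyclic window to the front, where the
      separating line applies.\<close>
    define ys where "ys = drop 4 (rotate i xs)"
    define a b c d where abcd: "a = xs ! (i mod n)" "b = xs ! ((i+1) mod n)"
      "c = xs ! ((i+2) mod n)" "d = xs ! ((i+3) mod n)"
    have "n \<ge> 4" using n True by presburger
    have "rotate i xs ! k = xs ! ((i + k) mod n)" if "k < n" for k
      using that nth_rotate[of k xs i] by (simp add: n_def add.commute)
    then have "take 4 (rotate i xs) = [a, b, c, d]"
      using \<open>n \<ge> 4\<close>
      by (intro nth_equalityI)
        (auto simp: abcd less_Suc_eq numeral_eq_Suc simp flip: n_def)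
    then have rot: "rotate i xs = [a, b, c, d] @ ys"
      by (metis append_take_drop_id ys_def)
    have dist: "distinct ([a, b, c, d] @ ys)" and ccw: "ccw ([a, b, c, d] @ ys)"
      and set_xs: "set xs = {a, b, c, d} \<union> set ys"
      using less.prems(1,2) ccw_rotate[of xs i] distinct_rotate[of i xs] set_rotate[of i xs]
      unfolding rot by auto
    let ?A = "{a, b, c, d}"
    have card_A: "card ?A = 4" using dist by simp
    have A_sub: "?A \<subseteq> R \<union> B" using set_xs less.prems(3) by blast
    have card_R: "card (set xs \<inter> R) = card (?A \<inter> R) + card (set ys \<inter> R)"
      using dist unfolding set_xs
      by (subst card_Un_disjoint[symmetric]) (auto intro!: arg_cong[where f = card])
    have card_B: "card (set xs \<inter> B) = card (?A \<inter> B) + card (set ys \<inter> B)"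
      using dist unfolding set_xs
      by (subst card_Un_disjoint[symmetric]) (auto intro!: arg_cong[where f = card])
    have card_AB: "card (?A \<inter> R) + card (?A \<inter> B) = 4"
      using assms(1) A_sub card_A
      by (subst card_Un_disjoint[symmetric]) (auto intro!: arg_cong[where f = card] simp: Int_absorb2 simp flip: Int_Un_distrib)
    have "card (?A \<inter> R) = \<rho> i + \<rho> (i+1) + \<rho> (i+2) + \<rho> (i+3)"
    proof -
      have "\<rho> i = (if a \<in> R then 1 else 0)" "\<rho> (i+1) = (if b \<in> R then 1 else 0)"
        "\<rho> (i+2) = (if c \<in> R then 1 else 0)" "\<rho> (i+3) = (if d \<in> R then 1 else 0)"
        by (simp_all add: \<rho>_def abcd)
      then show ?thesis using dist by (simp add: Int_insert_left)
    qed
    with i consider "card (?A \<inter> R) = 1" "h \<ge> 1" | "card (?A \<inter> R) = 3" "g \<ge> 1" by metis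
    \<comment> \<open>A star with one red and three blue points uses up one unit of
      \<open>h\<close>, the opposite star one unit of \<open>g\<close>.\<close>
    then obtain g' h' where gh': "g' + h' + 1 = g + h"
      and R': "card (set ys \<inter> R) + 1 = 3 * g' + h'" and B': "card (set ys \<inter> B) = 3 * h' + g'"
      and star: "card (?A \<inter> R) = 1 \<or> card (?A \<inter> B) = 1"
    proof cases
      case 1
      then show ?thesis
        using that[of g "h - 1"] card_R card_B card_AB less.prems(4,5) by simp
    next
      case 2
      then show ?thesis
        using that[of "g - 1" h] card_R card_B card_AB less.prems(4,5) by simp
    qed
    have "ccw ys" "distinct ys" "set ys \<subseteq> R \<union> B"
      using ccw_appendD2[OF ccw] dist set_xs less.prems(3) by auto
    with less.hyps[of g' h' ys] gh' R' B' obtain X where X: "X \<subseteq> set ys" "K13_coverable R B X"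
      "card X + 4 = 4 * (g' + h')" by auto
    have disj: "convex hull ?A \<inter> convex hull X = {}"
      using ccw_hulls_disjoint[OF ccw] hull_mono[OF X(1), of convex] by blast
    \<comment> \<open>The center is the only window point of its colour.\<close>
    obtain z where "z \<in> ?A" "z \<in> R \<and> ?A - {z} \<subseteq> B \<or> z \<in> B \<and> ?A - {z} \<subseteq> R"
    proof -
      have "\<exists>z\<in>A. z \<in> R \<and> A - {z} \<subseteq> B \<or> z \<in> B \<and> A - {z} \<subseteq> R"
        if "A \<subseteq> R \<union> B" "card (A \<inter> R) = 1 \<or> card (A \<inter> B) = 1" for A
      proof -
        from that(2) consider z where "A \<inter> R = {z}" | z where "A \<inter> B = {z}"
          by (metis card_1_singletonE)
        then show ?thesis by cases (use that(1) in blast)+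
      qed
      from this[OF A_sub star] show ?thesis using that by blast
    qed
    then have "K13_coverable R B (?A \<union> X)"
      using X(2) card_A disj A_sub assms(2)
      by (intro K13_coverable_Un) (auto simp: general_position_def)
    moreover have "card (?A \<union> X) = 4 + card X"
      using card_A dist X(1) finite_subset[OF X(1)] by (subst card_Un_disjoint) auto
    ultimately show ?thesis
      using X gh' set_xs by (intro exI[of _ "?A \<union> X"]) auto
  qed
qed

section \<open>An alternating configuration without a complete cover\<close>

definition par :: "real \<Rightarrow> real^2" where
  "par t = vector [t, t\<^sup>2]"

lemma par_nth [simp]: "par t $ 1 = t" "par t $ 2 = t\<^sup>2"
  by (simp_all add: par_def)

lemma par_eq_iff [simp]: "par s = par t \<longleftrightarrow> s = t"
  by (auto simp: vec_eq_iff forall_2)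

text \<open>This is a Vandermonde determinant; it vanishes only if two parameters coincide.\<close>

lemma orient_par: "orient (par r) (par s) (par t) = (s - r) * (t - r) * (t - s)"
  by (simp add: orient_def power2_eq_square algebra_simps)

lemma general_position_par: "general_position (par ` T)"
  unfolding general_position_def collinear_iff_orient by (auto simp: orient_par)

lemma convex_position_par:
  assumes "finite T"
  shows "convex_position (par ` T)"
  unfolding convex_position_def
proof clarify
  fix t assume t: "t \<in> T"
  \<comment> \<open>The open half-plane above the tangent at \<open>par t\<close>;
    \<open>par s\<close> exceeds the tangent by the square of \<open>s - t\<close>, so all other
    points lie in it.\<close>
  let ?H = "{x :: real^2. (vector [- 2 * t, 1] :: real^2) \<bullet> x > - t\<^sup>2}"
  have "par s \<in> ?H" if "s \<noteq> t" for s
  proof -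
    have "(s - t)\<^sup>2 > 0" using that by simp
    then show ?thesis by (simp add: inner_vec_def sum_2 power2_eq_square algebra_simps)
  qed
  then have "convex hull (par ` (T - {t})) \<subseteq> ?H"
    by (intro hull_minimal convex_halfspace_gt) auto
  moreover have "par t \<notin> ?H"
    by (simp add: inner_vec_def sum_2 power2_eq_square)
  ultimately have "par t \<notin> convex hull (par ` (T - {t}))"
    by blast
  then have "par t extreme_point_of convex hull (insert (par t) (par ` (T - {t})))"
    using assms by (intro extreme_point_of_convex_hull_insert) auto
  moreover have "insert (par t) (par ` (T - {t})) = par ` T"
    using t by blast
  ultimately show "par t extreme_point_of convex hull (par ` T)" by simp
qed

text \<open>The secant through \<open>par i\<close> and \<open>par j\<close> has slope
  \<open>i + j\<close> and intercept \<open>- i * j\<close>.\<close>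

lemma chord_par:
  assumes "i < j" "i \<le> x" "x \<le> j"
  shows "vector [x, (i + j) * x - i * j] \<in> closed_segment (par i) (par j)"
proof -
  define u where "u = (x - i) / (j - i)"
  have x: "x = i + u * (j - i)" using assms by (simp add: u_def)
  have "vector [x, (i + j) * x - i * j] = (1 - u) *\<^sub>R par i + u *\<^sub>R par j"
    by (simp add: x vec_eq_iff forall_2 power2_eq_square algebra_simps)
  moreover have "0 \<le> u" "u \<le> 1" using assms by (simp_all add: u_def)
  ultimately show ?thesis unfolding closed_segment_def by blast
qed

lemma chords_par_meet:
  assumes "i < k" "k < j" "j < l"
  shows "closed_segment (par i) (par j) \<inter> closed_segment (par k) (par l) \<noteq> {}"
proof -
  \<comment> \<open>The abscissa where the two secants agree.\<close>
  define x where "x = (k * l - i * j) / (k + l - i - j)"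
  have pos: "k + l - i - j > 0" using assms by simp
  \<comment> \<open>Over the common denominator, these products are the numerators of
    \<open>x - k\<close> and \<open>j - x\<close>.\<close>
  have "(k - i) * (j - k) > 0" "(j - k) * (l - j) > 0" using assms by simp_all
  then have "k \<le> x" "x \<le> j"
    using pos by (simp_all add: x_def field_simps)
  moreover have "x * (k + l - i - j) = k * l - i * j"
    using pos by (simp add: x_def)
  then have "(i + j) * x - i * j = (k + l) * x - k * l"
    by (simp add: algebra_simps)
  ultimately show ?thesis
    using chord_par[of i j x] chord_par[of k l x] assms by auto
qed

lemma chords_par_meet':
  assumes "i < k" "k < j" "l < i \<or> j < l"
  shows "closed_segment (par i) (par j) \<inter> closed_segment (par k) (par l) \<noteq> {}"
  using chords_par_meet[of i k j l] chords_par_meet[of l i k j] assms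
  by (auto simp: closed_segment_commute Int_commute)

section \<open>A block of consecutive points in a non-crossing cover\<close>

text \<open>The block of smallest span consists of consecutive points: a foreign point \<open>x\<close> inside its span
  belongs to a block that also has a point \<open>y\<close> outside, and the star path from \<open>x\<close> to \<open>y\<close> would
  cross the star of the given block.\<close>

lemma consecutive_block:
  fixes N :: nat
  assumes part: "partition_on ((\<lambda>i. par (real i)) ` {..<N}) P" and "N > 0"
    and ctr: "\<And>A. A \<in> P \<Longrightarrow> ctr A \<in> A"
    and nc: "non_crossing (star_edges P ctr)"
  shows "\<exists>A\<in>P. \<exists>a b. A = (\<lambda>i. par (real i)) ` {a..b}"
proof -
  let ?p = "\<lambda>i. par (real i)"
  define I where "I A = {i. ?p i \<in> A}" for A
  have UnP: "\<Union>P = ?p ` {..<N}" using part by (simp add: partition_on_def)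
  have A_eq: "A = ?p ` I A" if "A \<in> P" for A
  proof -
    have "A \<subseteq> ?p ` {..<N}" using UnP that by auto
    then show ?thesis by (auto simp: I_def)
  qed
  have I_sub: "I A \<subseteq> {..<N}" if "A \<in> P" for A
  proof
    fix i assume "i \<in> I A"
    then have "?p i \<in> \<Union>P" using that by (auto simp: I_def)
    then have "?p i \<in> ?p ` {..<N}" by (simp only: UnP)
    then show "i \<in> {..<N}" by auto
  qed
  have fin: "finite (I A)" if "A \<in> P" for A
    using I_sub[OF that] finite_subset by blast
  have ne: "I A \<noteq> {}" if "A \<in> P" for A
    using A_eq[OF that] that part by (auto simp: partition_on_def)
  have disj: "I A \<inter> I D = {}" if "A \<in> P" "D \<in> P" "A \<noteq> D" for A D
    using part that unfolding I_def partition_on_def disjoint_def by blast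
  have index: "\<exists>c\<in>I A. ?p c = ctr A" if "A \<in> P" for A
  proof -
    have "ctr A \<in> \<Union>P" using ctr that by blast
    then have "ctr A \<in> ?p ` {..<N}" by (simp only: UnP)
    then obtain c where "ctr A = ?p c" by blast
    then show ?thesis using ctr[OF that] by (auto simp: I_def)
  qed
  have edge: "(?p c, ?p q) \<in> star_edges P ctr"
    if "A \<in> P" "?p c = ctr A" "q \<in> I A" "q \<noteq> c" for A c q
    unfolding star_edges_def
    by (intro CollectI exI[of _ A] exI[of _ "?p q"]) (use that in \<open>auto simp: I_def simp flip: that(2)\<close>)
  \<comment> \<open>Chords with interlaced indices meet, yet their four endpoints are distinct, so
    no common endpoint can excuse the meeting.\<close>
  have cross: False
    if e: "(a, b) \<in> star_edges P ctr" "(a', b') \<in> star_edges P ctr" and "{a, b} = {?p lo, ?p hi}"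
      "{a', b'} = {?p k, ?p l}" and o: "lo < k" "k < hi" "l < lo \<or> hi < l" for a b a' b' lo hi k l
  proof -
    have "closed_segment a b \<inter> closed_segment a' b' = closed_segment (?p lo) (?p hi) \<inter> closed_segment (?p k) (?p l)"
      using that by (simp add: segment_convex_hull)
    then have "closed_segment a b \<inter> closed_segment a' b' \<noteq> {}"
      using chords_par_meet'[of lo k hi l] o by simp
    moreover have empty: "{a, b} \<inter> {a', b'} = {}"
      using that by auto
    then have "(a, b) \<noteq> (a', b')" by blast
    then have "closed_segment a b \<inter> closed_segment a' b' \<subseteq> {a, b} \<inter> {a', b'}"
      using nc e unfolding non_crossing_def by blast
    ultimately show False using empty by simp
  qed
  have "P \<noteq> {}" using UnP \<open>N > 0\<close> by auto
  then obtain A where A: "A \<in> P"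
    and min_span: "\<And>D. D \<in> P \<Longrightarrow> Max (I A) - Min (I A) \<le> Max (I D) - Min (I D)"
    using ex_has_least_nat[of "\<lambda>A. A \<in> P" _ "\<lambda>A. Max (I A) - Min (I A)"] by blast
  define a b where ab: "a = Min (I A)" "b = Max (I A)"
  have ab_in: "a \<in> I A" "b \<in> I A" using fin ne A by (simp_all add: ab)
  have bounds: "i \<in> I A \<Longrightarrow> a \<le> i \<and> i \<le> b" for i using fin A by (simp add: ab)
  have "x \<in> I A" if x: "a \<le> x" "x \<le> b" for x
  proof (rule ccontr)
    assume xA: "x \<notin> I A"
    then have x': "a < x" "x < b" using x ab_in by (metis le_neq_implies_less)+
    then have "?p x \<in> \<Union>P" using I_sub[OF A] ab_in(2) UnP by auto
    then obtain D where D: "D \<in> P" "x \<in> I D" unfolding I_def by blast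
    then have AD: "I A \<inter> I D = {}" using disj A xA by blast
    \<comment> \<open>Otherwise \<open>D\<close> would lie between \<open>a\<close> and
      \<open>b\<close> without containing \<open>a\<close>, and so have smaller span than
      \<open>A\<close>.\<close>
    obtain y where y: "y \<in> I D" "y < a \<or> b < y"
    proof (rule ccontr)
      assume "\<not> thesis"
      then have in_ab: "a \<le> y \<and> y \<le> b" if "y \<in> I D" for y
        using that \<open>\<And>y. y \<in> I D \<Longrightarrow> y < a \<or> b < y \<Longrightarrow> thesis\<close> not_le by blast
      have m: "Min (I D) \<in> I D" "Max (I D) \<in> I D" "Min (I D) \<le> Max (I D)"
        using fin ne D by auto
      then have "Min (I D) \<noteq> a" using AD ab_in by auto
      then have "Max (I D) - Min (I D) < b - a"
        using in_ab[OF m(1)] in_ab[OF m(2)] m(3) by linarith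
      then show False using min_span[OF D(1)] by (simp add: ab)
    qed
    obtain c where c: "c \<in> I A" "?p c = ctr A"
      using index[OF A] by blast
    obtain c' where c': "c' \<in> I D" "?p c' = ctr D"
      using index[OF D(1)] by blast
    have "c \<noteq> x" using c xA by blast
    \<comment> \<open>The edge of \<open>A\<close> passing over \<open>x\<close> joins the center to
      the extreme point, \<open>a\<close> or \<open>b\<close>, on the other side of
      \<open>x\<close>.\<close>
    obtain q lo hi where q: "q \<in> I A" "{c, q} = {lo, hi}" "a \<le> lo" "hi \<le> b" "lo < x" "x < hi" "q \<noteq> c"
    proof (cases "x < c")
      case True
      then show ?thesis using that[of a a c] ab_in x' bounds[OF c(1)] by auto
    next
      case False
      then show ?thesis using that[of b c b] ab_in x' bounds[OF c(1)] \<open>c \<noteq> x\<close> by auto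
    qed
    have eA: "(?p c, ?p q) \<in> star_edges P ctr" by (rule edge[OF A c(2) q(1,7)])
    have img: "{?p c, ?p q} = {?p lo, ?p hi}"
      using arg_cong[OF q(2), of "image ?p"] by simp
    have y_out: "y < lo \<or> hi < y" using y q by linarith
    have "lo \<in> I A" "hi \<in> I A" using q(1,2) c(1) by (auto simp: doubleton_eq_iff)
    then have "c' \<noteq> lo" "c' \<noteq> hi" using c'(1) AD by blast+
    \<comment> \<open>If the center \<open>c'\<close> of \<open>D\<close> lies under this edge, its
      edge to \<open>y\<close> crosses; if it lies outside, its edge to \<open>x\<close>
      does.\<close>
    then consider "lo < c'" "c' < hi" | "c' < lo \<or> hi < c'" by linarith
    then show False
    proof cases
      case 1
      then have "(?p c', ?p y) \<in> star_edges P ctr"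
        using y_out by (intro edge[OF D(1) c'(2) y(1)]) auto
      then show False using cross[OF eA _ img refl] 1 y_out by blast
    next
      case 2
      then have "(?p c', ?p x) \<in> star_edges P ctr"
        using q(5,6) by (intro edge[OF D(1) c'(2) D(2)]) auto
      then show False using cross[OF eA _ img, of "?p c'" "?p x" x c'] 2 q(5,6)
        by (simp add: insert_commute)
    qed
  qed
  then have "I A = {a..b}" using bounds by (intro set_eqI) (metis atLeastAtMost_iff)
  then show ?thesis using A A_eq[OF A] by metis
qed

lemma alternating_not_coverable:
  assumes "N > 0"
  shows "\<not> K13_coverable ((\<lambda>i. par (real i)) ` {i. i < N \<and> even i})
    ((\<lambda>i. par (real i)) ` {i. i < N \<and> odd i}) ((\<lambda>i. par (real i)) ` {..<N})"
proof
  let ?p = "\<lambda>i. par (real i)"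
  let ?R = "?p ` {i. i < N \<and> even i}" and ?B = "?p ` {i. i < N \<and> odd i}"
  assume "K13_coverable ?R ?B (?p ` {..<N})"
  then obtain P ctr where P: "partition_on (?p ` {..<N}) P"
    and "\<forall>A\<in>P. card A = 4 \<and> ctr A \<in> A \<and>
           (ctr A \<in> ?R \<and> A - {ctr A} \<subseteq> ?B \<or> ctr A \<in> ?B \<and> A - {ctr A} \<subseteq> ?R)"
    and nc: "non_crossing (star_edges P ctr)"
    unfolding K13_coverable_def by (elim exE conjE)
  note stars = this(2)[rule_format]
  obtain A a b where A: "A \<in> P" "A = ?p ` {a..b}"
    using consecutive_block[OF P assms _ nc] stars by blast
  have "card A = card {a..b}"
    unfolding A(2) by (rule card_image) (simp add: inj_on_def)
  then have b: "b = a + 3" using stars[OF A(1)] by simp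
  obtain c where c: "c \<in> {a..b}" "ctr A = ?p c" using stars[OF A(1)] A(2) by auto
  \<comment> \<open>Moving by two keeps the colour; the case split keeps \<open>d\<close> among the
    four indices from \<open>a\<close> to \<open>a + 3\<close>.\<close>
  define d where "d = (if c < a + 2 then c + 2 else c - 2)"
  have "d \<in> {a..b}" "d \<noteq> c" "even d \<longleftrightarrow> even c"
    using b c by (auto simp: d_def)
  then have "?p d \<in> A - {ctr A}" using A(2) c(2) by auto
  then have "?p c \<in> ?R \<and> ?p d \<in> ?B \<or> ?p c \<in> ?B \<and> ?p d \<in> ?R"
    using stars[OF A(1)] c(2) by auto
  then show False using \<open>even d \<longleftrightarrow> even c\<close> by auto
qed

text \<open>Turns the mere failure of a complete cover into a loss of at least four points.\<close>

lemma K13_coverable_card: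
  assumes "K13_coverable R B X"
  shows "4 dvd card X"
proof -
  obtain P where P: "partition_on X P" "\<forall>A\<in>P. card A = 4"
    using assms unfolding K13_coverable_def by metis
  have "card X = (\<Sum>A\<in>P. card A)"
    using P by (intro product_partition) (auto intro: card_ge_0_finite)
  then show ?thesis using P(2) by simp
qed

section \<open>Covering in general, and tightness for the alternating points\<close>

theorem theorem8:
  shows "(\<forall>(g::nat) (h::nat) (R::(real^2) set) (B::(real^2) set).
            finite R \<and> finite B \<and> R \<inter> B = {} \<and>
            card R = 3 * g + h \<and> card B = 3 * h + g \<and>
            convex_position (R \<union> B) \<and> general_position (R \<union> B) \<longrightarrow>
            (\<exists>X \<subseteq> R \<union> B. K13_coverable R B X \<and>
               int (card X) \<ge> 4 * (int g + int h) - 4))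
       \<and> (\<forall>g::nat. g \<ge> 1 \<longrightarrow>
            (\<exists>(R::(real^2) set) (B::(real^2) set).
               finite R \<and> finite B \<and> R \<inter> B = {} \<and>
               card R = 4 * g \<and> card B = 4 * g \<and>
               convex_position (R \<union> B) \<and> general_position (R \<union> B) \<and>
               (\<forall>X \<subseteq> R \<union> B. K13_coverable R B X \<longrightarrow>
                  int (card X) \<le> 8 * int g - 4)))"
proof (intro conjI allI impI, elim conjE)
  fix g h :: nat and R B :: "(real^2) set"
  assume fin: "finite R" "finite B" and disj: "R \<inter> B = {}"
    and card: "card R = 3 * g + h" "card B = 3 * h + g"
    and pos: "convex_position (R \<union> B)" "general_position (R \<union> B)"
  show "\<exists>X \<subseteq> R \<union> B. K13_coverable R B X \<and> int (card X) \<ge> 4 * (int g + int h) - 4"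
  proof (cases "R = {}")
    case True
    \<comment> \<open>Without red points \<open>g = h = 0\<close>, and the integer bound is
      -4.\<close>
    then show ?thesis using card K13_coverable_empty by (intro exI[of _ "{}"]) auto
  next
    case False
    then obtain p where p: "p \<in> R" by blast
    obtain xs where xs: "distinct xs" "set xs = R \<union> B" "ccw xs"
      using convex_position_ccw_list fin pos by (metis finite_UnI)
    obtain us vs where split: "xs = us @ p # vs"
      using p xs(2) by (metis UnCI in_set_conv_decomp)
    \<comment> \<open>The rotation puts \<open>p\<close> first, so that dropping it leaves a
      counterclockwise list.\<close>
    have "ccw (rotate (length us) xs)" by (rule ccw_rotate[OF xs(3)])
    then have ccw: "ccw (vs @ us)" by (simp add: split rotate_append)
    have dist: "distinct (vs @ us)" using xs(1) by (auto simp: split)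
    have set: "set (vs @ us) = R \<union> B - {p}"
      using xs(1,2) by (auto simp: split)
    have "set (vs @ us) \<inter> R = R - {p}" "set (vs @ us) \<inter> B = B"
      unfolding set using p disj by blast+
    moreover have "card (R - {p}) + 1 = card R"
      using p fin by (metis Suc_eq_plus1 card.remove)
    ultimately have "\<exists>X \<subseteq> set (vs @ us). K13_coverable R B X \<and> card X + 4 = 4 * (g + h)"
      using card set by (intro K13_coverable_ccw[OF disj pos(2) dist ccw]) auto
    then obtain X where "X \<subseteq> set (vs @ us)" "K13_coverable R B X" "card X + 4 = 4 * (g + h)" by blast
    then show ?thesis unfolding set by (intro exI[of _ X]) auto
  qed
next
  fix g :: nat
  assume "g \<ge> 1"
  let ?p = "\<lambda>i. par (real i)"
  let ?R = "?p ` {i. i < 8 * g \<and> even i}" and ?B = "?p ` {i. i < 8 * g \<and> odd i}"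
  have Un: "?R \<union> ?B = ?p ` {..<8 * g}" by auto
  have inj: "inj_on ?p T" for T by (simp add: inj_on_def)
  have "{i. i < 8 * g \<and> even i} = (\<lambda>i. 2 * i) ` {..<4 * g}" by (auto elim!: evenE)
  then have "card {i. i < 8 * g \<and> even i} = 4 * g" by (simp add: card_image inj_on_def)
  moreover have "{i. i < 8 * g \<and> odd i} = (\<lambda>i. 2 * i + 1) ` {..<4 * g}" by (auto elim!: oddE)
  then have "card {i. i < 8 * g \<and> odd i} = 4 * g" by (simp add: card_image inj_on_def)
  ultimately have cards: "card ?R = 4 * g" "card ?B = 4 * g"
    by (simp_all add: card_image[OF inj])
  have "int (card X) \<le> 8 * int g - 4" if X: "X \<subseteq> ?R \<union> ?B" "K13_coverable ?R ?B X" for X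
  proof -
    have "card X \<le> card (?p ` {..<8 * g})" using X(1) unfolding Un by (intro card_mono) auto
    moreover have "card (?p ` {..<8 * g}) = 8 * g" by (simp add: card_image[OF inj])
    moreover have "X \<noteq> ?p ` {..<8 * g}"
      using alternating_not_coverable[of "8 * g"] X(2) \<open>g \<ge> 1\<close> by auto
    then have "card X \<noteq> card (?p ` {..<8 * g})"
      using X(1) unfolding Un by (metis card_subset_eq finite_imageI finite_lessThan)
    \<comment> \<open>A multiple of 4 below \<open>8 * g\<close> is at most
      \<open>8 * g - 4\<close>.\<close>
    ultimately have "card X < 8 * g" by linarith
    moreover obtain k where "card X = 4 * k" using K13_coverable_card[OF X(2)] by blast
    ultimately have "k < 2 * g" "card X = 4 * k" by simp_all
    then show ?thesis by linarith
  qed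
  moreover have "?p ` {..<8 * g} = par ` real ` {..<8 * g}" by (simp add: image_image)
  then have "convex_position (?R \<union> ?B)" "general_position (?R \<union> ?B)"
    unfolding Un by (simp_all only: convex_position_par general_position_par finite_imageI finite_lessThan)
  moreover have "?R \<inter> ?B = {}" by auto
  ultimately show "\<exists>(R::(real^2) set) (B::(real^2) set).
               finite R \<and> finite B \<and> R \<inter> B = {} \<and>
               card R = 4 * g \<and> card B = 4 * g \<and>
               convex_position (R \<union> B) \<and> general_position (R \<union> B) \<and>
               (\<forall>X \<subseteq> R \<union> B. K13_coverable R B X \<longrightarrow>
                  int (card X) \<le> 8 * int g - 4)"
    using cards by (intro exI[of _ ?R] exI[of _ ?B]) auto
qed

end
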